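(* Let $f:\mathbb R^d\to\mathbb R$ be $L$-smooth with $f_*:=\inf_{x\in\mathbb R^d}f(x)>-\infty$, and suppose the gradient oracle is unbiased with $\sigma$-sub-Gaussian noise (see context). Let $\Delta_1:=f(x_1)-f_*$, $\delta\in(0,1)$, $T\ge1$, and let $(x_t)$ be the iterates of Stochastic Gradient Descent with step sizes $\{\eta_t\}$. (1) If $\eta_t=\min\left\{\frac1L;\sqrt{\frac{\Delta_1}{\sigma^2LT}}\right\}$ for all $t$, then with probability at least $1-\delta$, $$\frac1T\sum_{t=1}^T\|\nabla f(x_t)\|^2\le\frac{2\Delta_1L}{T}+5\sigma\sqrt{\frac{\Delta_1L}{T}}+\frac{12\sigma^2\log\frac1\delta}{T}.$$ (2) If $\eta_t=\frac1{L\sqrt t}$ for all $t$, then with probability at least $1-\delta$, $$\frac1T\sum_{t=1}^T\|\nabla f(x_t)\|^2\le\frac{2\Delta_1L+3\sigma^2(1+\log T)+12\sigma^2\log\frac1\delta}{\sqrt T}.$$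
   Context: $\|\cdot\|$ is the $\ell_2$ norm on $\mathbb R^d$. $f$ is $L$-smooth ($L>0$): $f$ is differentiable and $\|\nabla f(x)-\nabla f(y)\|\le L\|x-y\|$ for all $x,y$; $f$ need not be convex. Stochastic Gradient Descent: from a deterministic $x_1\in\mathbb R^d$, $x_{t+1}=x_t-\eta_t\widehat\nabla f(x_t)$ for $t=1,\dots,T$. Noise assumptions: a random variable $Y$ is $\sigma$-sub-Gaussian ($\sigma>0$) if $\mathbb E[\exp(\lambda^2Y^2)]\le\exp(\lambda^2\sigma^2)$ for all $|\lambda|\le 1/\sigma$. $\widehat\nabla f(x)$ is a history-independent stochastic gradient oracle with $\mathbb E[\widehat\nabla f(x)\mid x]=\nabla f(x)$ and $\|\widehat\nabla f(x)-\nabla f(x)\|$ $\sigma$-sub-Gaussian for every $x$. Thus, with $\xi_t=\widehat\nabla f(x_t)-\nabla f(x_t)$ and $\mathcal F_t=\sigma(\xi_1,\dots,\xi_{t-1})$ (so $x_t$ is $\mathcal F_t$-measurable): $\mathbb E[\xi_t\mid\mathcal F_t]=0$ and $\mathbb E[\exp(\lambda^2\|\xi_t\|^2)\mid\mathcal F_t]\le\exp(\lambda^2\sigma^2)$ for all $|\lambda|\le1/\sigma$. *)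

theory Defs
  imports "HOL-Probability.Probability"
begin

definition L_smooth ::
    "real \<Rightarrow> ('a::euclidean_space \<Rightarrow> real) \<Rightarrow> ('a \<Rightarrow> 'a) \<Rightarrow> bool" where
  "L_smooth L f gradf \<longleftrightarrow>
     L > 0 \<and> (\<forall>x. GDERIV f x :> gradf x) \<and>
     (\<forall>x y. norm (gradf x - gradf y) \<le> L * norm (x - y))"

text \<open>The expectation is a nonnegative integral with values in \<^typ>\<open>ennreal\<close>, so the bound
  includes its finiteness; a Bochner integral would be \<open>0\<close> when it diverges.\<close>

definition sub_gaussian :: "real \<Rightarrow> 's measure \<Rightarrow> ('s \<Rightarrow> real) \<Rightarrow> bool" where
  "sub_gaussian \<sigma> M Y \<longleftrightarrow>
     \<sigma> > 0 \<and> Y \<in> borel_measurable M \<and>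
     (\<forall>l. \<bar>l\<bar> \<le> 1 / \<sigma> \<longrightarrow>
        (\<integral>\<^sup>+\<omega>. ennreal (exp (l\<^sup>2 * (Y \<omega>)\<^sup>2)) \<partial>M) \<le> ennreal (exp (l\<^sup>2 * \<sigma>\<^sup>2)))"

text \<open>An oracle is a Markov kernel: \<open>K x\<close> is the law of the stochastic gradient returned
  for the query point \<open>x\<close>.\<close>

definition unbiased_sub_gaussian_oracle ::
    "real \<Rightarrow> ('a::euclidean_space \<Rightarrow> 'a) \<Rightarrow> ('a \<Rightarrow> 'a measure) \<Rightarrow> bool" where
  "unbiased_sub_gaussian_oracle \<sigma> gradf K \<longleftrightarrow>
     K \<in> borel \<rightarrow>\<^sub>M prob_algebra borel \<and>
     (\<forall>x. has_bochner_integral (K x) (\<lambda>g. g) (gradf x)) \<and>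
     (\<forall>x. sub_gaussian \<sigma> (K x) (\<lambda>g. norm (g - gradf x)))"

text \<open>The \<open>\<sigma>\<close>-algebra generated by \<open>\<xi> 1, \<dots>, \<xi> (t - 1)\<close>; it is trivial for \<open>t = 1\<close>.\<close>

definition noise_history ::
    "'s measure \<Rightarrow> (nat \<Rightarrow> 's \<Rightarrow> 'a::euclidean_space) \<Rightarrow> nat \<Rightarrow> 's measure" where
  "noise_history M \<xi> t =
     sigma (space M) {\<xi> s -` B \<inter> space M | s B. s \<in> {1..<t} \<and> B \<in> sets borel}"

text \<open>\<open>g t\<close> is the answer of the oracle at the iterate \<open>x t\<close>. History-independence: conditionally
  on the past noise, \<open>g t\<close> has law \<open>K (x t)\<close>.\<close>

definition SGD_run ::
    "'s measure \<Rightarrow> ('a::euclidean_space \<Rightarrow> 'a) \<Rightarrow> ('a \<Rightarrow> 'a measure) \<Rightarrow> (nat \<Rightarrow> real) \<Rightarrow> nat \<Rightarrow> 'a \<Rightarrow>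
      (nat \<Rightarrow> 's \<Rightarrow> 'a) \<Rightarrow> (nat \<Rightarrow> 's \<Rightarrow> 'a) \<Rightarrow> bool" where
  "SGD_run M gradf K \<eta> T x1 x g \<longleftrightarrow>
     (\<forall>\<omega>\<in>space M. x 1 \<omega> = x1) \<and>
     (\<forall>t\<in>{1..T}. \<forall>\<omega>\<in>space M. x (t + 1) \<omega> = x t \<omega> - \<eta> t *\<^sub>R g t \<omega>) \<and>
     (\<forall>t\<in>{1..T}. g t \<in> borel_measurable M) \<and>
     (\<forall>t\<in>{1..T}. \<forall>A\<in>sets borel. AE \<omega> in M.
        real_cond_exp M (noise_history M (\<lambda>s \<omega>. g s \<omega> - gradf (x s \<omega>)) t)
          (indicator {\<omega> \<in> space M. g t \<omega> \<in> A}) \<omega> = measure (K (x t \<omega>)) A)"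

end

theory Submission
  imports Defs
begin

text \<open>
  One step of stochastic gradient descent with \<open>\<eta> \<le> 1 / L\<close>, expanded by the quadratic upper bound
  that smoothness gives, satisfies
  \<open>f (x - \<eta> y) - f x \<le> - \<eta> (1 - L \<eta> / 2) \<parallel>\<nabla>f x\<parallel>\<^sup>2 - \<eta> (1 - L \<eta>) \<langle>\<nabla>f x, \<xi>\<rangle> + L \<eta>\<^sup>2 / 2 \<parallel>\<xi>\<parallel>\<^sup>2\<close>
  with noise \<open>\<xi> = y - \<nabla>f x\<close>. The noise enters through a linear term, which has mean zero, and a
  quadratic term, which is small. For centred sub-Gaussian \<open>\<xi>\<close> the exponential moment of such a sum,
  \<open>E exp (\<langle>a, \<xi>\<rangle> + b \<parallel>\<xi>\<parallel>\<^sup>2)\<close>, is at most \<open>exp (3 (\<parallel>a\<parallel>\<^sup>2 + b) \<sigma>\<^sup>2)\<close>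
  (\<open>sub_gaussian_vector_mgf\<close>). With \<open>a\<close> proportional to \<open>w \<eta> \<nabla>f x\<close> the price of the linear term is
  of order \<open>w\<^sup>2 \<eta>\<^sup>2 \<sigma>\<^sup>2 \<parallel>\<nabla>f x\<parallel>\<^sup>2\<close>; if \<open>6 \<sigma>\<^sup>2 \<eta> w \<le> 1\<close>, the descent term \<open>w \<eta> \<parallel>\<nabla>f x\<parallel>\<^sup>2\<close>
  pays for it and still leaves \<open>w \<eta> \<parallel>\<nabla>f x\<parallel>\<^sup>2 / 2\<close> (\<open>sgd_step_nn_integral_le_1\<close>).

  Consequently \<open>exp (w \<Phi>\<^sub>t)\<close> is a supermartingale started at \<open>1\<close>, where
  \<open>\<Phi>\<^sub>t = f x\<^sub>t - f x\<^sub>1 + \<Sum>i<t. (\<eta>\<^sub>i / 2 \<parallel>\<nabla>f x\<^sub>i\<parallel>\<^sup>2 - 3 / 2 \<sigma>\<^sup>2 L \<eta>\<^sub>i\<^sup>2)\<close>. Markov's inequality for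
  it with \<open>w = 1 / (6 \<sigma>\<^sup>2 max \<eta>)\<close> yields, with probability at least \<open>1 - \<delta>\<close>,
  \<open>\<Sum>t\<le>T. \<eta>\<^sub>t \<parallel>\<nabla>f x\<^sub>t\<parallel>\<^sup>2 \<le> 2 \<Delta>1 + 3 \<sigma>\<^sup>2 L \<Sum>t\<le>T. \<eta>\<^sub>t\<^sup>2 + 12 \<sigma>\<^sup>2 (max \<eta>) ln (1 / \<delta>)\<close>
  (\<open>weighted_gradient_bound\<close>), and both rates are obtained by inserting the step sizes.

  The supermartingale step integrates out \<open>g t\<close> given the past. As the past enters only through
  conditional probabilities of events \<open>g t \<in> A\<close>, these first have to be turned into a disintegration
  of the joint law of the past and \<open>g t\<close> (\<open>nn_integral_regular_conditional_distribution\<close>).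
\<close>

section \<open>Smooth functions\<close>

text \<open>Along the segment, the gap between \<open>f\<close> and its quadratic model has derivative
  \<open>\<langle>\<nabla>f (x + s d) - \<nabla>f x, d\<rangle> - L s \<parallel>d\<parallel>\<^sup>2\<close>, which is nonpositive by the Lipschitz bound.\<close>

lemma L_smooth_descent:
  fixes f :: "'a::euclidean_space \<Rightarrow> real"
  assumes "L_smooth L f gradf"
  shows "f (x + d) \<le> f x + inner (gradf x) d + L / 2 * (norm d)\<^sup>2"
proof -
  have D: "\<And>x. (f has_derivative (\<lambda>h. inner h (gradf x))) (at x)"
    and Lip: "\<And>x y. norm (gradf x - gradf y) \<le> L * norm (x - y)"
    using assms by (auto simp: L_smooth_def gderiv_def)
  define \<phi> where "\<phi> s = f (x + s *\<^sub>R d) - s * inner (gradf x) d - L / 2 * s\<^sup>2 * (norm d)\<^sup>2" for s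
  have "\<phi> 1 \<le> \<phi> 0"
  proof (rule DERIV_nonpos_imp_nonincreasing[where f=\<phi>])
    fix s :: real assume s: "0 \<le> s" "s \<le> 1"
    define D' where "D' = inner d (gradf (x + s *\<^sub>R d)) - inner (gradf x) d - L * s * (norm d)\<^sup>2"
    have "((\<lambda>s. x + s *\<^sub>R d) has_derivative (\<lambda>h. h *\<^sub>R d)) (at s)"
      by (auto intro!: derivative_eq_intros)
    from has_derivative_compose[OF this D]
    have "((\<lambda>s. f (x + s *\<^sub>R d)) has_real_derivative inner d (gradf (x + s *\<^sub>R d))) (at s)"
      by (simp add: has_field_derivative_def mult_commute_abs)
    then have "(\<phi> has_real_derivative D') (at s)"
      unfolding \<phi>_def D'_def by (auto intro!: derivative_eq_intros)
    moreover have "D' \<le> 0"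
    proof -
      have "inner d (gradf (x + s *\<^sub>R d)) - inner (gradf x) d
              = inner d (gradf (x + s *\<^sub>R d) - gradf x)"
        by (simp add: inner_diff_right inner_commute)
      also have "\<dots> \<le> norm d * norm (gradf (x + s *\<^sub>R d) - gradf x)"
        by (rule norm_cauchy_schwarz)
      also have "\<dots> \<le> norm d * (L * norm (s *\<^sub>R d))"
        using Lip[of "x + s *\<^sub>R d" x] by (intro mult_left_mono) auto
      also have "\<dots> = L * s * (norm d)\<^sup>2"
        using s by (simp add: power2_eq_square)
      finally show ?thesis by (simp add: D'_def)
    qed
    ultimately show "\<exists>y. (\<phi> has_real_derivative y) (at s) \<and> y \<le> 0" by blast
  qed simp
  then show ?thesis by (simp add: \<phi>_def)
qed

lemma L_smooth_gradient_continuous: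
  assumes "L_smooth L f gradf"
  shows "continuous_on UNIV gradf"
proof (rule lipschitz_on_continuous_on)
  show "L-lipschitz_on UNIV gradf"
    using assms by (auto simp: L_smooth_def lipschitz_on_def dist_norm)
qed

lemma L_smooth_continuous:
  assumes "L_smooth L f gradf"
  shows "continuous_on UNIV f"
  using assms unfolding L_smooth_def gderiv_def
  by (intro continuous_at_imp_continuous_on) (auto intro: has_derivative_continuous)

text \<open>A gradient step of length \<open>1 / L\<close> lowers \<open>f\<close> by at least \<open>\<parallel>\<nabla>f x\<parallel>\<^sup>2 / (2 L)\<close> and cannot go
  below the infimum. In particular the gradient vanishes at a minimiser.\<close>

lemma L_smooth_norm_gradient_le:
  fixes f :: "'a::euclidean_space \<Rightarrow> real"
  assumes sm: "L_smooth L f gradf" and bdd: "bdd_below (range f)"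
  shows "(norm (gradf x))\<^sup>2 \<le> 2 * L * (f x - (INF y. f y))"
proof -
  have L: "L > 0" using sm by (simp add: L_smooth_def)
  have "(INF y. f y) \<le> f (x + (- (1 / L)) *\<^sub>R gradf x)"
    by (rule cINF_lower[OF bdd]) simp
  also have "\<dots> \<le> f x + inner (gradf x) ((- (1 / L)) *\<^sub>R gradf x)
                    + L / 2 * (norm ((- (1 / L)) *\<^sub>R gradf x))\<^sup>2"
    by (rule L_smooth_descent[OF sm])
  also have "\<dots> = f x - (norm (gradf x))\<^sup>2 / (2 * L)"
    using L by (simp add: dot_square_norm power_mult_distrib field_simps power2_eq_square)
  finally show ?thesis using L by (simp add: field_simps)
qed

section \<open>Exponential moments of sub-Gaussian vectors\<close>

lemma exp_le_add_exp_square: "exp s \<le> s + exp (s\<^sup>2)" for s :: real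
proof -
  have sq: "1 + s\<^sup>2 \<le> exp (s\<^sup>2)" by (rule exp_ge_add_one_self)
  consider "s > 1" | "0 \<le> s" "s \<le> 1" | "s < 0" by linarith
  then show ?thesis
  proof cases
    case 1
    then have "s \<le> s\<^sup>2" by (simp add: power2_eq_square)
    then have "exp s \<le> exp (s\<^sup>2)" by simp
    then show ?thesis using 1 by linarith
  next
    case 2
    then show ?thesis using exp_bound[of s] sq by linarith
  next
    case 3
    \<comment> \<open>For \<open>u = - s\<close> this is \<open>exp (- u) \<le> 1 / (1 + u) \<le> 1 - u + u\<^sup>2\<close>.\<close>
    have "1 \<le> (1 - s) * (1 + s + s\<^sup>2)"
    proof -
      have "(1 - s) * (1 + s + s\<^sup>2) = 1 + s\<^sup>2 * (- s)"
        by (simp add: algebra_simps power2_eq_square)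
      then show ?thesis using 3 by (simp add: mult_nonneg_nonpos)
    qed
    also have "\<dots> \<le> exp (- s) * (1 + s + s\<^sup>2)"
    proof (rule mult_right_mono)
      show "1 - s \<le> exp (- s)" using exp_ge_add_one_self[of "- s"] by simp
      have "0 \<le> 3 / 4 + (s + 1 / 2)\<^sup>2" by simp
      then show "0 \<le> 1 + s + s\<^sup>2" by (simp add: power2_eq_square algebra_simps)
    qed
    finally have "exp s * 1 \<le> exp s * (exp (- s) * (1 + s + s\<^sup>2))"
      by (intro mult_left_mono) auto
    then have "exp s \<le> 1 + s + s\<^sup>2"
      by (simp add: mult.assoc[symmetric] exp_add[symmetric])
    then show ?thesis using sq by linarith
  qed
qed

text \<open>The additive \<open>s\<close> on the right is there to disappear in expectation when \<open>s\<close> is centred; what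
  remains is quadratic in \<open>s\<close>. With \<open>A = exp (s\<^sup>2)\<close> and \<open>B = exp v\<close>, the previous bound multiplied
  by \<open>B\<close> leaves the excess \<open>s (B - 1) + A B \<le> A (2 B - 1)\<close>, and \<open>2 B - 1 \<le> B\<^sup>2\<close>.\<close>

lemma exp_add_le_add_exp:
  fixes s v :: real
  assumes "v \<ge> 0"
  shows "exp (s + v) \<le> s + exp (s\<^sup>2 + 2 * v)"
proof -
  define A B where "A = exp (s\<^sup>2)" and "B = exp v"
  have B: "B \<ge> 1" and A: "A > 0" using assms by (auto simp: A_def B_def)
  have "s \<le> A"
    using exp_le_add_exp_square[of "- s"] exp_gt_zero[of "- s"] by (simp add: A_def del: exp_gt_zero)
  then have "s * (B - 1) \<le> A * (B - 1)"
    using B by (intro mult_right_mono) auto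
  moreover have "exp (s + v) \<le> (s + A) * B"
    using exp_le_add_exp_square[of s] by (simp add: exp_add A_def B_def)
  moreover have "A * (2 * B - 1) \<le> A * B\<^sup>2"
  proof (rule mult_left_mono)
    have "0 \<le> (B - 1)\<^sup>2" by simp
    then show "2 * B - 1 \<le> B\<^sup>2" by (simp add: power2_eq_square algebra_simps)
  qed (use A in simp)
  moreover have "exp (s\<^sup>2 + 2 * v) = A * B\<^sup>2"
    by (simp add: A_def B_def exp_add power2_eq_square exp_double)
  ultimately show ?thesis by (simp add: algebra_simps)
qed

lemma sub_gaussian_nn_integral_exp_le:
  assumes "sub_gaussian \<sigma> P Y" and "0 \<le> c" and "c * \<sigma>\<^sup>2 \<le> 1"
  shows "(\<integral>\<^sup>+\<omega>. ennreal (exp (c * (Y \<omega>)\<^sup>2)) \<partial>P) \<le> ennreal (exp (c * \<sigma>\<^sup>2))"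
proof -
  have \<sigma>: "\<sigma> > 0" using assms(1) by (simp add: sub_gaussian_def)
  have "sqrt c * \<sigma> = sqrt (c * \<sigma>\<^sup>2)"
    using \<sigma> by (simp add: real_sqrt_mult)
  then have "sqrt c * \<sigma> \<le> 1"
    using assms(3) by simp
  then have "\<bar>sqrt c\<bar> \<le> 1 / \<sigma>"
    using assms(2) \<sigma> by (simp add: field_simps)
  then show ?thesis
    using assms(1,2) unfolding sub_gaussian_def by (metis real_sqrt_pow2)
qed

text \<open>If \<open>\<parallel>a\<parallel>\<close> is of order at most \<open>1 / \<sigma>\<close>, centring removes the linear term at the cost of
  replacing the exponent by \<open>(\<parallel>a\<parallel>\<^sup>2 + 2 b) \<parallel>y - m\<parallel>\<^sup>2\<close>, to which the sub-Gaussian bound applies.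
  For larger \<open>a\<close>, Young's inequality
  \<open>\<parallel>a\<parallel> r \<le> \<sigma>\<^sup>2 \<parallel>a\<parallel>\<^sup>2 + r\<^sup>2 / (4 \<sigma>\<^sup>2)\<close> suffices, because the constant \<open>1 / 4\<close> it produces is then
  dominated by \<open>\<sigma>\<^sup>2 \<parallel>a\<parallel>\<^sup>2\<close>.\<close>

lemma sub_gaussian_vector_mgf:
  fixes P :: "'a::euclidean_space measure"
  assumes P: "prob_space P" and mean: "has_bochner_integral P (\<lambda>y. y) m"
    and sg: "sub_gaussian \<sigma> P (\<lambda>y. norm (y - m))"
    and b: "0 \<le> b" "4 * b * \<sigma>\<^sup>2 \<le> 1"
  shows "(\<integral>\<^sup>+y. ennreal (exp (inner a (y - m) + b * (norm (y - m))\<^sup>2)) \<partial>P)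
           \<le> ennreal (exp (3 * ((norm a)\<^sup>2 + b) * \<sigma>\<^sup>2))"
proof -
  interpret prob_space P by (rule P)
  have \<sigma>: "\<sigma> > 0" using sg by (simp add: sub_gaussian_def)
  have id_meas[measurable]: "(\<lambda>y. y) \<in> borel_measurable P"
    using mean by (rule has_bochner_integral_iff[THEN iffD1, THEN conjunct1, THEN borel_measurable_integrable])
  show ?thesis
  proof (cases "((norm a)\<^sup>2 + 2 * b) * \<sigma>\<^sup>2 \<le> 1")
    case True
    define c where "c = (norm a)\<^sup>2 + 2 * b"
    have c: "0 \<le> c" using b by (simp add: c_def)
    define E where "E y = exp (c * (norm (y - m))\<^sup>2)" for y
    have E_le: "(\<integral>\<^sup>+y. ennreal (E y) \<partial>P) \<le> ennreal (exp (c * \<sigma>\<^sup>2))"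
      unfolding E_def using sub_gaussian_nn_integral_exp_le[OF sg c] True by (simp add: c_def)
    have E_meas[measurable]: "E \<in> borel_measurable P" unfolding E_def by measurable
    have E_int: "integrable P E"
    proof (rule integrableI_bounded)
      have "(\<integral>\<^sup>+y. ennreal (norm (E y)) \<partial>P) = (\<integral>\<^sup>+y. ennreal (E y) \<partial>P)"
        by (simp add: E_def)
      then show "(\<integral>\<^sup>+y. ennreal (norm (E y)) \<partial>P) < \<infinity>"
        using E_le by (simp add: le_less_trans)
    qed simp
    have int: "integrable P (\<lambda>y. y)" and m: "(\<integral>y. y \<partial>P) = m"
      using mean by (auto simp: has_bochner_integral_iff)
    have lin_int: "integrable P (\<lambda>y. inner a (y - m))"
      using int by (intro integrable_inner_right integrable_diff) auto
    have lin: "(\<integral>y. inner a (y - m) \<partial>P) = 0"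
      using int m by (simp add: integral_inner_right prob_space)
    have pw: "exp (inner a (y - m) + b * (norm (y - m))\<^sup>2) \<le> inner a (y - m) + E y" for y
    proof -
      have "exp (inner a (y - m) + b * (norm (y - m))\<^sup>2)
              \<le> inner a (y - m) + exp ((inner a (y - m))\<^sup>2 + 2 * (b * (norm (y - m))\<^sup>2))"
        by (rule exp_add_le_add_exp) (use b in simp)
      also have "(inner a (y - m))\<^sup>2 \<le> (norm a * norm (y - m))\<^sup>2"
        using Cauchy_Schwarz_ineq2[of a "y - m"] by (metis power2_abs power_mono abs_ge_zero)
      finally show ?thesis
        by (simp add: E_def c_def power_mult_distrib algebra_simps)
    qed
    have "(\<integral>\<^sup>+y. ennreal (exp (inner a (y - m) + b * (norm (y - m))\<^sup>2)) \<partial>P)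
            \<le> (\<integral>\<^sup>+y. ennreal (inner a (y - m) + E y) \<partial>P)"
      by (intro nn_integral_mono ennreal_leI pw)
    also have "\<dots> = ennreal (\<integral>y. inner a (y - m) + E y \<partial>P)"
      using lin_int E_int
      by (intro nn_integral_eq_integral Bochner_Integration.integrable_add AE_I2
            order_trans[OF exp_ge_zero pw])
    also have "\<dots> = ennreal (\<integral>y. E y \<partial>P)"
      using lin lin_int E_int by simp
    also have "\<dots> = (\<integral>\<^sup>+y. ennreal (E y) \<partial>P)"
      by (rule nn_integral_eq_integral[OF E_int, symmetric]) (simp add: E_def)
    also have "\<dots> \<le> ennreal (exp (c * \<sigma>\<^sup>2))" by (rule E_le)
    also have "\<dots> \<le> ennreal (exp (3 * ((norm a)\<^sup>2 + b) * \<sigma>\<^sup>2))"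
      using b by (intro ennreal_leI) (simp add: c_def mult_right_mono)
    finally show ?thesis .
  next
    case False
    define c where "c = 1 / (4 * \<sigma>\<^sup>2) + b"
    have c: "0 \<le> c" "c * \<sigma>\<^sup>2 = 1 / 4 + b * \<sigma>\<^sup>2"
      using b \<sigma> by (auto simp: c_def field_simps)
    have pw: "exp (inner a (y - m) + b * (norm (y - m))\<^sup>2)
                \<le> exp (\<sigma>\<^sup>2 * (norm a)\<^sup>2) * exp (c * (norm (y - m))\<^sup>2)" for y
    proof -
      have "inner a (y - m) \<le> norm a * norm (y - m)" by (rule norm_cauchy_schwarz)
      also have "\<dots> \<le> \<sigma>\<^sup>2 * (norm a)\<^sup>2 + 1 / (4 * \<sigma>\<^sup>2) * (norm (y - m))\<^sup>2"
      proof -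
        have "0 \<le> (\<sigma> * norm a - norm (y - m) / (2 * \<sigma>))\<^sup>2" by simp
        then show ?thesis using \<sigma> by (simp add: power2_eq_square field_simps)
      qed
      finally show ?thesis by (simp add: exp_add[symmetric] c_def algebra_simps)
    qed
    have "(\<integral>\<^sup>+y. ennreal (exp (inner a (y - m) + b * (norm (y - m))\<^sup>2)) \<partial>P)
            \<le> (\<integral>\<^sup>+y. ennreal (exp (\<sigma>\<^sup>2 * (norm a)\<^sup>2)) * ennreal (exp (c * (norm (y - m))\<^sup>2)) \<partial>P)"
      by (intro nn_integral_mono) (use pw in \<open>simp add: ennreal_mult[symmetric] ennreal_leI\<close>)
    also have "\<dots> = ennreal (exp (\<sigma>\<^sup>2 * (norm a)\<^sup>2)) * (\<integral>\<^sup>+y. ennreal (exp (c * (norm (y - m))\<^sup>2)) \<partial>P)"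
      by (intro nn_integral_cmult) measurable
    also have "\<dots> \<le> ennreal (exp (\<sigma>\<^sup>2 * (norm a)\<^sup>2)) * ennreal (exp (c * \<sigma>\<^sup>2))"
      using sub_gaussian_nn_integral_exp_le[OF sg c(1)] b c(2) by (intro mult_left_mono) auto
    also have "\<dots> = ennreal (exp (\<sigma>\<^sup>2 * (norm a)\<^sup>2 + c * \<sigma>\<^sup>2))"
      by (simp add: ennreal_mult[symmetric] exp_add)
    also have "\<dots> \<le> ennreal (exp (3 * ((norm a)\<^sup>2 + b) * \<sigma>\<^sup>2))"
    proof -
      have "0 \<le> b * \<sigma>\<^sup>2" using b by simp
      moreover have "(norm a)\<^sup>2 * \<sigma>\<^sup>2 + 2 * (b * \<sigma>\<^sup>2) > 1" using False by (simp add: algebra_simps)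
      ultimately have "\<sigma>\<^sup>2 * (norm a)\<^sup>2 + c * \<sigma>\<^sup>2 \<le> 3 * ((norm a)\<^sup>2 + b) * \<sigma>\<^sup>2"
        using b(2) c(2) by (simp add: algebra_simps)
      then show ?thesis by (intro ennreal_leI) simp
    qed
    finally show ?thesis .
  qed
qed

section \<open>One step of stochastic gradient descent\<close>

text \<open>Here \<open>h\<close> is the step size. Expanding at \<open>y = \<nabla>f x + \<xi>\<close> gives a linear form with coefficient
  \<open>a = - w h (1 - L h) \<nabla>f x\<close>, a quadratic one with \<open>b = w L h\<^sup>2 / 2\<close>, and a deterministic rest \<open>- R\<close>
  that contains \<open>- w h (1 - L h) \<parallel>\<nabla>f x\<parallel>\<^sup>2 / 2\<close>. The moment bound costs \<open>3 \<sigma>\<^sup>2 \<parallel>a\<parallel>\<^sup>2\<close>, that is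
  \<open>3 \<sigma>\<^sup>2 w\<^sup>2 h\<^sup>2 (1 - L h)\<^sup>2 \<parallel>\<nabla>f x\<parallel>\<^sup>2\<close>, which that descent term covers since \<open>6 \<sigma>\<^sup>2 h w \<le> 1\<close>; the cost
  \<open>3 \<sigma>\<^sup>2 b\<close> is exactly the term \<open>3 / 2 \<sigma>\<^sup>2 w L h\<^sup>2\<close>.\<close>

lemma sgd_step_nn_integral_le_1:
  fixes f :: "'a::euclidean_space \<Rightarrow> real"
  assumes sm: "L_smooth L f gradf" and orc: "unbiased_sub_gaussian_oracle \<sigma> gradf K"
    and w: "0 \<le> w" and h: "0 < h" "L * h \<le> 1" and wh: "6 * \<sigma>\<^sup>2 * h * w \<le> 1"
  shows "(\<integral>\<^sup>+y. ennreal (exp (w * (f (x - h *\<^sub>R y) - f x + h / 2 * (norm (gradf x))\<^sup>2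
            - 3 / 2 * \<sigma>\<^sup>2 * L * h\<^sup>2))) \<partial>K x) \<le> 1"
proof -
  define G where "G = (norm (gradf x))\<^sup>2"
  define q where "q = 1 - L * h"
  define a where "a = (- (w * h * q)) *\<^sub>R gradf x"
  define b where "b = w * (L * h\<^sup>2 / 2)"
  define R where "R = w * (h / 2) * q * G + 3 / 2 * \<sigma>\<^sup>2 * w * L * h\<^sup>2"
  have L: "L > 0" using sm by (simp add: L_smooth_def)
  have P: "prob_space (K x)"
    using orc unfolding unbiased_sub_gaussian_oracle_def
    by (auto dest!: measurable_space[of K borel _ x] simp: space_prob_algebra)
  have setsK[measurable_cong]: "sets (K x) = sets borel"
    using orc unfolding unbiased_sub_gaussian_oracle_def
    by (auto dest!: measurable_space[of K borel _ x] simp: space_prob_algebra)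
  have mean: "has_bochner_integral (K x) (\<lambda>y. y) (gradf x)"
    and sg: "sub_gaussian \<sigma> (K x) (\<lambda>y. norm (y - gradf x))"
    using orc by (auto simp: unbiased_sub_gaussian_oracle_def)
  have q: "0 \<le> q" "q \<le> 1" using h L by (auto simp: q_def)
  have b: "0 \<le> b" "4 * b * \<sigma>\<^sup>2 \<le> 1"
  proof -
    have "4 * b * \<sigma>\<^sup>2 = (L * h) * (2 * \<sigma>\<^sup>2 * h * w)" by (simp add: b_def power2_eq_square)
    also have "\<dots> \<le> 1 * (2 * \<sigma>\<^sup>2 * h * w)" using h w by (intro mult_right_mono) auto
    also have "\<dots> \<le> 6 * \<sigma>\<^sup>2 * h * w" using h w by simp
    finally show "4 * b * \<sigma>\<^sup>2 \<le> 1" using wh by linarith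
    show "0 \<le> b" using w h L by (simp add: b_def)
  qed
  have pw: "w * (f (x - h *\<^sub>R y) - f x + h / 2 * G - 3 / 2 * \<sigma>\<^sup>2 * L * h\<^sup>2)
              \<le> (inner a (y - gradf x) + b * (norm (y - gradf x))\<^sup>2) + (- R)" for y
  proof -
    have "f (x - h *\<^sub>R y) - f x \<le> - h * inner (gradf x) y + L / 2 * h\<^sup>2 * (norm y)\<^sup>2"
      using L_smooth_descent[OF sm, of x "- h *\<^sub>R y"] by (simp add: power_mult_distrib)
    then have "w * (f (x - h *\<^sub>R y) - f x + h / 2 * G - 3 / 2 * \<sigma>\<^sup>2 * L * h\<^sup>2)
        \<le> w * (- h * inner (gradf x) y + L / 2 * h\<^sup>2 * (norm y)\<^sup>2 + h / 2 * G - 3 / 2 * \<sigma>\<^sup>2 * L * h\<^sup>2)"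
      using w by (intro mult_left_mono) auto
    also have "\<dots> = (inner a (y - gradf x) + b * (norm (y - gradf x))\<^sup>2) + (- R)"
    proof -
      have a: "inner a (y - gradf x) = - (w * h * q) * (inner (gradf x) y - G)"
        by (simp add: a_def G_def inner_diff_right power2_norm_eq_inner algebra_simps)
      have n: "(norm (y - gradf x))\<^sup>2 = (norm y)\<^sup>2 - 2 * inner (gradf x) y + G"
        by (simp add: G_def power2_norm_eq_inner inner_diff_left inner_diff_right inner_commute)
      show ?thesis
        unfolding a n b_def R_def q_def by (simp add: field_simps power2_eq_square)
    qed
    finally show ?thesis .
  qed
  have "(\<integral>\<^sup>+y. ennreal (exp (w * (f (x - h *\<^sub>R y) - f x + h / 2 * G - 3 / 2 * \<sigma>\<^sup>2 * L * h\<^sup>2))) \<partial>K x)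
      \<le> (\<integral>\<^sup>+y. ennreal (exp (inner a (y - gradf x) + b * (norm (y - gradf x))\<^sup>2)) * ennreal (exp (- R)) \<partial>K x)"
    by (intro nn_integral_mono) (use pw in \<open>simp add: ennreal_mult[symmetric] exp_add[symmetric] ennreal_leI\<close>)
  also have "\<dots> = (\<integral>\<^sup>+y. ennreal (exp (inner a (y - gradf x) + b * (norm (y - gradf x))\<^sup>2)) \<partial>K x) * ennreal (exp (- R))"
    by (intro nn_integral_multc) measurable
  also have "\<dots> \<le> ennreal (exp (3 * ((norm a)\<^sup>2 + b) * \<sigma>\<^sup>2)) * ennreal (exp (- R))"
    by (intro mult_right_mono sub_gaussian_vector_mgf P mean sg b) auto
  also have "\<dots> = ennreal (exp (3 * ((norm a)\<^sup>2 + b) * \<sigma>\<^sup>2 - R))"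
    by (simp add: ennreal_mult[symmetric] exp_add[symmetric])
  also have "\<dots> \<le> 1"
  proof -
    have "(6 * \<sigma>\<^sup>2 * h * w) * q \<le> 1 * 1"
      using wh q h w by (intro mult_mono) auto
    then have "(w * (h / 2) * q * G) * ((6 * \<sigma>\<^sup>2 * h * w) * q) \<le> (w * (h / 2) * q * G) * 1"
      using w h q by (intro mult_left_mono) (auto simp: G_def)
    moreover have "(norm a)\<^sup>2 = (w * h * q)\<^sup>2 * G"
      by (simp add: a_def G_def power_mult_distrib)
    ultimately have "3 * ((norm a)\<^sup>2 + b) * \<sigma>\<^sup>2 - R \<le> 0"
      by (simp add: R_def b_def power2_eq_square algebra_simps)
    then show ?thesis by (simp add: ennreal_le_1)
  qed
  finally show ?thesis by (simp add: G_def)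
qed

section \<open>Integration against a conditional distribution\<close>

text \<open>The hypothesis determines the joint law of the past and \<open>G\<close> on rectangles \<open>A \<times> B\<close> with
  \<open>A \<in> sets N\<close>: it agrees there with the law obtained by drawing \<open>\<omega>\<close> and then a point from \<open>\<kappa> \<omega>\<close>.
  Rectangles form a \<open>\<inter>\<close>-stable generator, so the two laws coincide.\<close>

lemma (in prob_space) nn_integral_regular_conditional_distribution:
  assumes sub: "subalgebra M N"
    and \<kappa>: "\<kappa> \<in> N \<rightarrow>\<^sub>M prob_algebra S"
    and G[measurable]: "G \<in> M \<rightarrow>\<^sub>M S"
    and cond: "\<And>A. A \<in> sets S \<Longrightarrow> AE \<omega> in M.
        real_cond_exp M N (indicator {\<omega> \<in> space M. G \<omega> \<in> A}) \<omega> = measure (\<kappa> \<omega>) A"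
    and h[measurable]: "h \<in> borel_measurable (N \<Otimes>\<^sub>M S)"
  shows "(\<integral>\<^sup>+\<omega>. h (\<omega>, G \<omega>) \<partial>M) = (\<integral>\<^sup>+\<omega>. \<integral>\<^sup>+y. h (\<omega>, y) \<partial>\<kappa> \<omega> \<partial>M)"
proof -
  interpret finite_measure_subalgebra M N
    by unfold_locales (rule sub)
  have spN: "space N = space M" using sub by (simp add: subalgebra_def)
  have id[measurable]: "(\<lambda>\<omega>. \<omega>) \<in> M \<rightarrow>\<^sub>M N"
    using sub by (intro measurable_from_subalg[OF sub]) simp
  have \<kappa>'[measurable]: "\<kappa> \<in> N \<rightarrow>\<^sub>M subprob_algebra S" by (rule measurable_prob_algebraD[OF \<kappa>])
  have \<kappa>s: "sets (\<kappa> \<omega>) = sets S" "prob_space (\<kappa> \<omega>)" if "\<omega> \<in> space M" for \<omega>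
    using measurable_space[OF \<kappa>, of \<omega>] that by (auto simp: space_prob_algebra spN)
  define Q where "Q \<omega> = distr (\<kappa> \<omega>) (N \<Otimes>\<^sub>M S) (Pair \<omega>)" for \<omega>
  have Q[measurable]: "Q \<in> N \<rightarrow>\<^sub>M subprob_algebra (N \<Otimes>\<^sub>M S)"
    unfolding Q_def by (rule measurable_distr2[where M=S]) measurable
  have QM[measurable]: "Q \<in> M \<rightarrow>\<^sub>M subprob_algebra (N \<Otimes>\<^sub>M S)"
    by (rule measurable_from_subalg[OF sub Q])
  have Qint: "(\<integral>\<^sup>+z. k z \<partial>Q \<omega>) = (\<integral>\<^sup>+y. k (\<omega>, y) \<partial>\<kappa> \<omega>)"
    if "\<omega> \<in> space M" and [measurable]: "k \<in> borel_measurable (N \<Otimes>\<^sub>M S)" for \<omega> k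
  proof -
    have [measurable_cong]: "sets (\<kappa> \<omega>) = sets S" by (rule \<kappa>s(1)[OF that(1)])
    have [measurable]: "Pair \<omega> \<in> \<kappa> \<omega> \<rightarrow>\<^sub>M N \<Otimes>\<^sub>M S" using that by (simp add: spN)
    show ?thesis unfolding Q_def by (rule nn_integral_distr) measurable
  qed
  define E where "E = {a \<times> b | a b. a \<in> sets N \<and> b \<in> sets S}"
  have "distr M (N \<Otimes>\<^sub>M S) (\<lambda>\<omega>. (\<omega>, G \<omega>)) = M \<bind> Q"
  proof (rule measure_eqI_generator_eq[where E=E and \<Omega>="space N \<times> space S"
        and A="\<lambda>_. space N \<times> space S"])
    show "Int_stable E" unfolding E_def by (rule Int_stable_pair_measure_generator)
    show "E \<subseteq> Pow (space N \<times> space S)" unfolding E_def by (rule pair_measure_closed)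
    show "sets (distr M (N \<Otimes>\<^sub>M S) (\<lambda>\<omega>. (\<omega>, G \<omega>))) = sigma_sets (space N \<times> space S) E"
      by (simp add: sets_pair_measure E_def)
    show "sets (M \<bind> Q) = sigma_sets (space N \<times> space S) E"
      by (subst sets_bind[where N="N \<Otimes>\<^sub>M S"])
        (auto simp: sets_pair_measure E_def not_empty subprob_measurableD[OF QM])
    show "range (\<lambda>_. space N \<times> space S) \<subseteq> E" by (auto simp: E_def)
    show "emeasure (distr M (N \<Otimes>\<^sub>M S) (\<lambda>\<omega>. (\<omega>, G \<omega>))) (space N \<times> space S) \<noteq> \<infinity>"
      using emeasure_finite[of "(\<lambda>\<omega>. (\<omega>, G \<omega>)) -` (space N \<times> space S) \<inter> space M"]
      by (simp add: emeasure_distr)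
    fix X assume "X \<in> E"
    then obtain A B where X: "X = A \<times> B" and A: "A \<in> sets N" and B[measurable]: "B \<in> sets S"
      by (auto simp: E_def)
    have AM[measurable]: "A \<in> sets M" using A sub by (auto simp: subalgebra_def)
    define C where "C = {\<omega> \<in> space M. G \<omega> \<in> B}"
    have C[measurable]: "C \<in> sets M" unfolding C_def by measurable
    have meas\<kappa>[measurable]: "(\<lambda>\<omega>. measure (\<kappa> \<omega>) B) \<in> borel_measurable M"
      by (rule measurable_from_subalg[OF sub]) measurable
    have "emeasure (distr M (N \<Otimes>\<^sub>M S) (\<lambda>\<omega>. (\<omega>, G \<omega>))) X = emeasure M (A \<inter> C)"
      using sets.sets_into_space[OF AM] A unfolding X
      by (subst emeasure_distr) (auto intro!: arg_cong[where f="emeasure M"] simp: C_def)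
    also have "\<dots> = ennreal (\<integral>\<omega>\<in>A. indicator C \<omega> \<partial>M)"
      by (simp add: emeasure_eq_measure set_lebesgue_integral_def indicator_inter_arith[symmetric])
    also have "(\<integral>\<omega>\<in>A. indicator C \<omega> \<partial>M) = (\<integral>\<omega>\<in>A. real_cond_exp M N (indicator C) \<omega> \<partial>M)"
      by (rule real_cond_exp_intA[OF _ A]) (simp add: integrable_real_indicator emeasure_eq_measure)
    also have "\<dots> = (\<integral>\<omega>\<in>A. measure (\<kappa> \<omega>) B \<partial>M)"
      using cond[OF B] unfolding C_def[symmetric]
      by (intro set_lebesgue_integral_cong_AE) (auto simp: borel_measurable_cond_exp2)
    also have "ennreal \<dots> = (\<integral>\<^sup>+\<omega>. ennreal (indicator A \<omega> * measure (\<kappa> \<omega>) B) \<partial>M)"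
      unfolding set_lebesgue_integral_def real_scaleR_def
    proof (rule nn_integral_eq_integral[symmetric])
      show "integrable M (\<lambda>\<omega>. indicator A \<omega> * measure (\<kappa> \<omega>) B)"
        by (rule integrable_const_bound[where B=1])
          (auto intro!: AE_I2 simp: indicator_def prob_space.prob_le_1[OF \<kappa>s(2)])
    qed auto
    also have "\<dots> = (\<integral>\<^sup>+\<omega>. emeasure (Q \<omega>) X \<partial>M)"
    proof (rule nn_integral_cong)
      fix \<omega> assume \<omega>: "\<omega> \<in> space M"
      interpret k: prob_space "\<kappa> \<omega>" by (rule \<kappa>s(2)[OF \<omega>])
      have [measurable]: "Pair \<omega> \<in> \<kappa> \<omega> \<rightarrow>\<^sub>M N \<Otimes>\<^sub>M S"
        using \<omega> \<kappa>s(1)[OF \<omega>] by (simp add: spN cong: measurable_cong_sets)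
      have "emeasure (Q \<omega>) X = emeasure (\<kappa> \<omega>) (Pair \<omega> -` X \<inter> space (\<kappa> \<omega>))"
        unfolding Q_def X using A by (subst emeasure_distr) auto
      also have "Pair \<omega> -` X \<inter> space (\<kappa> \<omega>) = (if \<omega> \<in> A then B else {})"
        using sets.sets_into_space[OF B] sets_eq_imp_space_eq[OF \<kappa>s(1)[OF \<omega>]] by (auto simp: X)
      finally show "ennreal (indicator A \<omega> * measure (\<kappa> \<omega>) B) = emeasure (Q \<omega>) X"
        by (auto simp: k.emeasure_eq_measure)
    qed
    also have "\<dots> = emeasure (M \<bind> Q) X"
      using A unfolding X by (intro emeasure_bind[OF not_empty QM, symmetric]) auto
    finally show "emeasure (distr M (N \<Otimes>\<^sub>M S) (\<lambda>\<omega>. (\<omega>, G \<omega>))) X = emeasure (M \<bind> Q) X" .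
  qed auto
  then have "(\<integral>\<^sup>+z. h z \<partial>distr M (N \<Otimes>\<^sub>M S) (\<lambda>\<omega>. (\<omega>, G \<omega>))) = (\<integral>\<^sup>+z. h z \<partial>(M \<bind> Q))"
    by simp
  then have "(\<integral>\<^sup>+\<omega>. h (\<omega>, G \<omega>) \<partial>M) = (\<integral>\<^sup>+\<omega>. \<integral>\<^sup>+z. h z \<partial>Q \<omega> \<partial>M)"
    by (simp add: nn_integral_distr nn_integral_bind[OF h QM])
  also have "\<dots> = (\<integral>\<^sup>+\<omega>. \<integral>\<^sup>+y. h (\<omega>, y) \<partial>\<kappa> \<omega> \<partial>M)"
    by (intro nn_integral_cong Qint h)
  finally show ?thesis .
qed


section \<open>The exponential supermartingale\<close>

locale sgd = prob_space M for M :: "'s measure" +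
  fixes f :: "'a::euclidean_space \<Rightarrow> real" and gradf :: "'a \<Rightarrow> 'a" and K :: "'a \<Rightarrow> 'a measure"
    and \<eta> :: "nat \<Rightarrow> real" and T :: nat and x1 :: 'a and x g :: "nat \<Rightarrow> 's \<Rightarrow> 'a" and L \<sigma> :: real
  assumes f_smooth: "L_smooth L f gradf"
    and K_oracle: "unbiased_sub_gaussian_oracle \<sigma> gradf K"
    and g_run: "SGD_run M gradf K \<eta> T x1 x g"
begin

abbreviation "\<xi> \<equiv> \<lambda>s \<omega>. g s \<omega> - gradf (x s \<omega>)"
abbreviation "\<F> \<equiv> noise_history M \<xi>"

lemma gradf_measurable[measurable]: "gradf \<in> borel_measurable borel"
  using L_smooth_gradient_continuous[OF f_smooth] by (rule borel_measurable_continuous_onI)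

lemma f_measurable[measurable]: "f \<in> borel_measurable borel"
  using L_smooth_continuous[OF f_smooth] by (rule borel_measurable_continuous_onI)

lemma K_measurable[measurable]: "K \<in> borel \<rightarrow>\<^sub>M prob_algebra borel"
  using K_oracle by (simp add: unbiased_sub_gaussian_oracle_def)

lemma g_measurable: "t \<in> {1..T} \<Longrightarrow> g t \<in> borel_measurable M"
  using g_run by (simp add: SGD_run_def)

lemma x_1: "\<omega> \<in> space M \<Longrightarrow> x 1 \<omega> = x1"
  using g_run by (simp add: SGD_run_def)

lemma x_Suc: "t \<in> {1..T} \<Longrightarrow> \<omega> \<in> space M \<Longrightarrow> x (Suc t) \<omega> = x t \<omega> - \<eta> t *\<^sub>R g t \<omega>"
  using g_run by (simp add: SGD_run_def)

lemma x_measurable_M: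
  "1 \<le> t \<Longrightarrow> t \<le> Suc T \<Longrightarrow> x t \<in> borel_measurable M"
proof (induction t rule: dec_induct)
  case base
  then show ?case using x_1 by (simp cong: measurable_cong)
next
  case (step n)
  then have [measurable]: "x n \<in> borel_measurable M" "g n \<in> borel_measurable M"
    by (auto simp: g_measurable)
  have "(\<lambda>\<omega>. x n \<omega> - \<eta> n *\<^sub>R g n \<omega>) \<in> borel_measurable M" by measurable
  then show ?case
    using x_Suc[of n] step.hyps step.prems by (subst measurable_cong) auto
qed

lemma space_noise_history: "space (\<F> t) = space M"
  by (auto simp: noise_history_def intro!: space_measure_of)

lemma sets_noise_history:
  "sets (\<F> t) = sigma_sets (space M) {\<xi> s -` B \<inter> space M | s B. s \<in> {1..<t} \<and> B \<in> sets borel}"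
  unfolding noise_history_def by (intro sets_measure_of) auto

lemma subalgebra_noise_history:
  assumes "t \<le> Suc T"
  shows "subalgebra M (\<F> t)"
proof -
  have "\<xi> s -` B \<inter> space M \<in> sets M" if "s \<in> {1..<t}" "B \<in> sets borel" for s B
  proof -
    have [measurable]: "x s \<in> borel_measurable M" "g s \<in> borel_measurable M"
      using that assms x_measurable_M[of s] g_measurable[of s] by auto
    have "\<xi> s \<in> borel_measurable M" by measurable
    then show ?thesis using that(2) by (rule measurable_sets)
  qed
  then show ?thesis
    unfolding subalgebra_def space_noise_history sets_noise_history
    by (auto intro!: sets.sigma_sets_subset)
qed

lemma noise_measurable_history:
  assumes "s \<in> {1..<t}"
  shows "\<xi> s \<in> borel_measurable (\<F> t)"
proof (rule measurableI)
  fix B :: "'a set" assume "B \<in> sets borel"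
  then show "\<xi> s -` B \<inter> space (\<F> t) \<in> sets (\<F> t)"
    unfolding space_noise_history sets_noise_history
    using assms by (intro sigma_sets.Basic) blast
qed simp

text \<open>The history is generated by the noise rather than by the answers \<open>g s\<close>, but together with
  \<open>x s\<close> the noise gives back \<open>g s = \<xi> s + \<nabla>f (x s)\<close>, so the recursion can be run inside the history.\<close>

lemma x_measurable_history:
  assumes "t \<le> Suc T"
  shows "1 \<le> s \<Longrightarrow> s \<le> t \<Longrightarrow> x s \<in> borel_measurable (\<F> t)"
proof (induction s rule: dec_induct)
  case base
  show ?case
    using x_1 by (subst measurable_cong[where g="\<lambda>_. x1"]) (auto simp: space_noise_history)
next
  case (step n)
  then have [measurable]: "x n \<in> borel_measurable (\<F> t)" "\<xi> n \<in> borel_measurable (\<F> t)"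
    using noise_measurable_history[of n t] by auto
  have "(\<lambda>\<omega>. x n \<omega> - \<eta> n *\<^sub>R (\<xi> n \<omega> + gradf (x n \<omega>))) \<in> borel_measurable (\<F> t)" by measurable
  then show ?case
    using x_Suc[of n] step.hyps step.prems assms
    by (subst measurable_cong) (auto simp: space_noise_history)
qed

text \<open>This is \<open>\<Phi>\<^sub>t\<close> above. The sum stops at \<open>t - 1\<close>, so the potential at time \<open>t\<close> depends on
  \<open>x 1, \<dots>, x t\<close> and hence only on the noise before time \<open>t\<close>.\<close>

definition potential :: "nat \<Rightarrow> 's \<Rightarrow> real" where
  "potential t \<omega> = f (x t \<omega>) - f x1
     + (\<Sum>i=1..<t. \<eta> i / 2 * (norm (gradf (x i \<omega>)))\<^sup>2 - 3 / 2 * \<sigma>\<^sup>2 * L * (\<eta> i)\<^sup>2)"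

lemma potential_measurable_history:
  assumes "1 \<le> t" "t \<le> Suc T"
  shows "potential t \<in> borel_measurable (\<F> t)"
proof -
  have [measurable]: "x s \<in> borel_measurable (\<F> t)" if "1 \<le> s" "s \<le> t" for s
    using x_measurable_history[OF assms(2)] that by auto
  show ?thesis
    unfolding potential_def using assms by measurable
qed

lemma nn_integral_conditional_oracle:
  assumes t: "t \<in> {1..T}" and h: "h \<in> borel_measurable (\<F> t \<Otimes>\<^sub>M borel)"
  shows "(\<integral>\<^sup>+\<omega>. h (\<omega>, g t \<omega>) \<partial>M) = (\<integral>\<^sup>+\<omega>. \<integral>\<^sup>+y. h (\<omega>, y) \<partial>K (x t \<omega>) \<partial>M)"
proof (rule nn_integral_regular_conditional_distribution[OF _ _ _ _ h])
  show "subalgebra M (\<F> t)" using t by (intro subalgebra_noise_history) simp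
  have [measurable]: "x t \<in> borel_measurable (\<F> t)"
    using t by (intro x_measurable_history) auto
  show "(\<lambda>\<omega>. K (x t \<omega>)) \<in> \<F> t \<rightarrow>\<^sub>M prob_algebra borel" by measurable
  show "g t \<in> borel_measurable M" using t by (rule g_measurable)
  show "AE \<omega> in M. real_cond_exp M (\<F> t) (indicator {\<omega> \<in> space M. g t \<omega> \<in> A}) \<omega>
          = measure (K (x t \<omega>)) A" if "A \<in> sets borel" for A
    using g_run t that by (simp add: SGD_run_def)
qed

text \<open>Given the past, the increment of the potential is the quantity bounded in
  \<open>sgd_step_nn_integral_le_1\<close>, with the oracle's answer drawn from \<open>K (x t)\<close>.\<close>

lemma nn_integral_exp_potential_le_1:
  assumes w: "0 \<le> w"
    and \<eta>: "\<And>t. t \<in> {1..T} \<Longrightarrow> 0 < \<eta> t \<and> L * \<eta> t \<le> 1 \<and> 6 * \<sigma>\<^sup>2 * \<eta> t * w \<le> 1"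
  shows "1 \<le> t \<Longrightarrow> t \<le> Suc T \<Longrightarrow> (\<integral>\<^sup>+\<omega>. ennreal (exp (w * potential t \<omega>)) \<partial>M) \<le> 1"
proof (induction t rule: dec_induct)
  case base
  have "(\<integral>\<^sup>+\<omega>. ennreal (exp (w * potential 1 \<omega>)) \<partial>M) = (\<integral>\<^sup>+\<omega>. 1 \<partial>M)"
    by (intro nn_integral_cong) (simp add: potential_def x_1[simplified])
  then show ?case by (simp add: emeasure_space_1)
next
  case (step t)
  have t: "t \<in> {1..T}" using step by simp
  define Z where "Z x y = w * (f (x - \<eta> t *\<^sub>R y) - f x + \<eta> t / 2 * (norm (gradf x))\<^sup>2
            - 3 / 2 * \<sigma>\<^sup>2 * L * (\<eta> t)\<^sup>2)" for x y
  define h where "h = (\<lambda>(\<omega>, y). ennreal (exp (w * potential t \<omega>)) * ennreal (exp (Z (x t \<omega>) y)))"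
  have [measurable]: "x t \<in> borel_measurable (\<F> t)" "potential t \<in> borel_measurable (\<F> t)"
    using t by (auto intro!: x_measurable_history potential_measurable_history)
  have h: "h \<in> borel_measurable (\<F> t \<Otimes>\<^sub>M borel)"
    unfolding h_def Z_def by measurable
  have "(\<integral>\<^sup>+\<omega>. ennreal (exp (w * potential (Suc t) \<omega>)) \<partial>M) = (\<integral>\<^sup>+\<omega>. h (\<omega>, g t \<omega>) \<partial>M)"
  proof (rule nn_integral_cong)
    fix \<omega> assume "\<omega> \<in> space M"
    then have "w * potential (Suc t) \<omega> = w * potential t \<omega> + Z (x t \<omega>) (g t \<omega>)"
      using t by (simp add: potential_def Z_def x_Suc algebra_simps)
    then show "ennreal (exp (w * potential (Suc t) \<omega>)) = h (\<omega>, g t \<omega>)"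
      by (simp add: h_def exp_add ennreal_mult)
  qed
  also have "\<dots> = (\<integral>\<^sup>+\<omega>. \<integral>\<^sup>+y. h (\<omega>, y) \<partial>K (x t \<omega>) \<partial>M)"
    by (rule nn_integral_conditional_oracle[OF t h])
  also have "\<dots> \<le> (\<integral>\<^sup>+\<omega>. ennreal (exp (w * potential t \<omega>)) \<partial>M)"
  proof (rule nn_integral_mono)
    fix \<omega>
    have [measurable_cong]: "sets (K (x t \<omega>)) = sets borel"
      using measurable_space[OF K_measurable, of "x t \<omega>"] by (simp add: space_prob_algebra)
    have "(\<integral>\<^sup>+y. h (\<omega>, y) \<partial>K (x t \<omega>))
        = ennreal (exp (w * potential t \<omega>)) * (\<integral>\<^sup>+y. ennreal (exp (Z (x t \<omega>) y)) \<partial>K (x t \<omega>))"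
      unfolding h_def Z_def by (simp, intro nn_integral_cmult) measurable
    also have "\<dots> \<le> ennreal (exp (w * potential t \<omega>)) * 1"
      unfolding Z_def using \<eta>[OF t] w
      by (intro mult_left_mono sgd_step_nn_integral_le_1[OF f_smooth K_oracle]) auto
    finally show "(\<integral>\<^sup>+y. h (\<omega>, y) \<partial>K (x t \<omega>)) \<le> ennreal (exp (w * potential t \<omega>))" by simp
  qed
  also have "\<dots> \<le> 1" using step t by simp
  finally show ?case .
qed

lemma potential_tail:
  assumes w: "0 < w"
    and \<eta>: "\<And>t. t \<in> {1..T} \<Longrightarrow> 0 < \<eta> t \<and> L * \<eta> t \<le> 1 \<and> 6 * \<sigma>\<^sup>2 * \<eta> t * w \<le> 1"
    and \<delta>: "0 < \<delta>"
  shows "\<P>(\<omega> in M. potential (Suc T) \<omega> \<le> ln (1 / \<delta>) / w) \<ge> 1 - \<delta>"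
proof -
  have [measurable]: "potential (Suc T) \<in> borel_measurable M"
    by (rule measurable_from_subalg[OF subalgebra_noise_history potential_measurable_history]) auto
  define B where "B = {\<omega> \<in> space M. 1 \<le> ennreal \<delta> * ennreal (exp (w * potential (Suc T) \<omega>))}"
  have [measurable]: "B \<in> events" unfolding B_def by measurable
  have "emeasure M B
      \<le> ennreal \<delta> * (\<integral>\<^sup>+\<omega>. ennreal (exp (w * potential (Suc T) \<omega>)) * indicator (space M) \<omega> \<partial>M)"
    unfolding B_def by (rule nn_integral_Markov_inequality) auto
  also have "(\<integral>\<^sup>+\<omega>. ennreal (exp (w * potential (Suc T) \<omega>)) * indicator (space M) \<omega> \<partial>M)
      = (\<integral>\<^sup>+\<omega>. ennreal (exp (w * potential (Suc T) \<omega>)) \<partial>M)"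
    by (intro nn_integral_cong) simp
  also have "ennreal \<delta> * \<dots> \<le> ennreal \<delta> * 1"
    using w \<eta> by (intro mult_left_mono nn_integral_exp_potential_le_1) auto
  finally have "prob B \<le> \<delta>"
    using \<delta> by (simp add: emeasure_eq_measure)
  then have "1 - \<delta> \<le> prob (space M - B)"
    by (simp add: prob_compl)
  also have "\<dots> \<le> \<P>(\<omega> in M. potential (Suc T) \<omega> \<le> ln (1 / \<delta>) / w)"
  proof (rule finite_measure_mono)
    show "space M - B \<subseteq> {\<omega> \<in> space M. potential (Suc T) \<omega> \<le> ln (1 / \<delta>) / w}"
    proof safe
      fix \<omega> assume "\<omega> \<in> space M" "\<omega> \<notin> B"
      then have "\<delta> * exp (w * potential (Suc T) \<omega>) < 1"
        using \<delta> by (simp add: B_def ennreal_mult[symmetric] not_le)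
      then have "exp (w * potential (Suc T) \<omega>) < 1 / \<delta>"
        using \<delta> by (simp add: field_simps)
      then have "w * potential (Suc T) \<omega> < ln (1 / \<delta>)"
        using \<delta> by (metis exp_gt_zero exp_less_cancel_iff exp_ln order_less_trans)
      then show "potential (Suc T) \<omega> \<le> ln (1 / \<delta>) / w"
        using w by (simp add: field_simps)
    qed
  qed measurable
  finally show ?thesis .
qed

text \<open>The choice \<open>w = 1 / (6 \<sigma>\<^sup>2 h)\<close> is the largest that is admissible for all steps up to \<open>h\<close>, and
  so gives the smallest confidence term \<open>ln (1 / \<delta>) / w\<close>. The final value \<open>f (x (T + 1))\<close> in the
  potential is bounded below by the infimum.\<close>

lemma weighted_gradient_bound:
  assumes bdd: "bdd_below (range f)" and T: "T \<ge> 1"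
    and \<eta>: "\<And>t. t \<in> {1..T} \<Longrightarrow> 0 < \<eta> t \<and> L * \<eta> t \<le> 1 \<and> \<eta> t \<le> h"
    and \<delta>: "0 < \<delta>"
  shows "\<P>(\<omega> in M. (\<Sum>t=1..T. \<eta> t * (norm (gradf (x t \<omega>)))\<^sup>2)
            \<le> 2 * (f x1 - (INF y. f y)) + 3 * \<sigma>\<^sup>2 * L * (\<Sum>t=1..T. (\<eta> t)\<^sup>2)
              + 12 * \<sigma>\<^sup>2 * h * ln (1 / \<delta>)) \<ge> 1 - \<delta>"
proof -
  have \<sigma>: "\<sigma> > 0" using K_oracle by (auto simp: unbiased_sub_gaussian_oracle_def sub_gaussian_def)
  have h: "h > 0" using \<eta>[of 1] T by auto
  define w where "w = 1 / (6 * \<sigma>\<^sup>2 * h)"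
  have w: "w > 0" using \<sigma> h by (simp add: w_def)
  have step: "0 < \<eta> t \<and> L * \<eta> t \<le> 1 \<and> 6 * \<sigma>\<^sup>2 * \<eta> t * w \<le> 1" if "t \<in> {1..T}" for t
    using \<eta>[OF that] h \<sigma> by (simp add: w_def)
  have [measurable]: "x t \<in> borel_measurable M" if "1 \<le> t" "t \<le> T" for t
    using x_measurable_M[of t] that by simp
  have "1 - \<delta> \<le> \<P>(\<omega> in M. potential (Suc T) \<omega> \<le> ln (1 / \<delta>) / w)"
    by (rule potential_tail[OF w step \<delta>])
  also have "\<dots> \<le> \<P>(\<omega> in M. (\<Sum>t=1..T. \<eta> t * (norm (gradf (x t \<omega>)))\<^sup>2)
            \<le> 2 * (f x1 - (INF y. f y)) + 3 * \<sigma>\<^sup>2 * L * (\<Sum>t=1..T. (\<eta> t)\<^sup>2)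
              + 12 * \<sigma>\<^sup>2 * h * ln (1 / \<delta>))"
  proof (rule finite_measure_mono, safe)
    fix \<omega> assume pot: "potential (Suc T) \<omega> \<le> ln (1 / \<delta>) / w"
    define U V where "U = \<sigma>\<^sup>2 * L * (\<Sum>t=1..T. (\<eta> t)\<^sup>2)" and "V = \<sigma>\<^sup>2 * h * ln (1 / \<delta>)"
    have inf: "(INF y. f y) \<le> f (x (Suc T) \<omega>)"
      by (rule cINF_lower[OF bdd]) simp
    have sum: "(\<Sum>i=1..<Suc T. \<eta> i / 2 * (norm (gradf (x i \<omega>)))\<^sup>2 - 3 / 2 * \<sigma>\<^sup>2 * L * (\<eta> i)\<^sup>2)
        = (\<Sum>t=1..T. \<eta> t * (norm (gradf (x t \<omega>)))\<^sup>2) / 2 - 3 / 2 * U"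
      unfolding atLeastLessThanSuc_atLeastAtMost
      by (simp add: U_def sum_subtractf sum_divide_distrib sum_distrib_left mult.assoc)
    have "ln (1 / \<delta>) / w = 6 * V"
      by (simp add: w_def V_def)
    then have "f (x (Suc T) \<omega>) - f x1
        + ((\<Sum>t=1..T. \<eta> t * (norm (gradf (x t \<omega>)))\<^sup>2) / 2 - 3 / 2 * U) \<le> 6 * V"
      using pot unfolding potential_def sum by simp
    then have "(\<Sum>t=1..T. \<eta> t * (norm (gradf (x t \<omega>)))\<^sup>2)
        \<le> 2 * (f x1 - (INF y. f y)) + 3 * U + 12 * V"
      using inf by (simp add: field_simps)
    then show "(\<Sum>t=1..T. \<eta> t * (norm (gradf (x t \<omega>)))\<^sup>2)
            \<le> 2 * (f x1 - (INF y. f y)) + 3 * \<sigma>\<^sup>2 * L * (\<Sum>t=1..T. (\<eta> t)\<^sup>2)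
              + 12 * \<sigma>\<^sup>2 * h * ln (1 / \<delta>)"
      unfolding U_def V_def by (simp only: mult.assoc)
  next
    show "{\<omega> \<in> space M. (\<Sum>t=1..T. \<eta> t * (norm (gradf (x t \<omega>)))\<^sup>2)
            \<le> 2 * (f x1 - (INF y. f y)) + 3 * \<sigma>\<^sup>2 * L * (\<Sum>t=1..T. (\<eta> t)\<^sup>2)
              + 12 * \<sigma>\<^sup>2 * h * ln (1 / \<delta>)} \<in> events"
      by measurable
  qed
  finally show ?thesis .
qed

end

section \<open>Convergence rates\<close>

lemma sum_inverse_le_1_plus_ln:
  assumes "n \<ge> 1"
  shows "(\<Sum>t=1..n. 1 / real t) \<le> 1 + ln (real n)"
proof -
  obtain k where k: "n = Suc k" using assms by (cases n) auto
  have "harm (Suc k) - ln (Suc k) \<le> harm (Suc 0) - (ln (Suc 0) :: real)"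
    using decseq_harm_diff_ln by (rule decseqD) simp
  then show ?thesis
    by (simp add: k harm_def inverse_eq_divide)
qed

text \<open>For the constant step size \<open>h = min (1 / L) s\<close> with \<open>s = sqrt (\<Delta>1 / (\<sigma>\<^sup>2 L T))\<close>, division by
  \<open>h T\<close> leaves \<open>2 \<Delta>1 / (h T) + 3 \<sigma>\<^sup>2 L h\<close>, where \<open>1 / h \<le> L + 1 / s\<close> and \<open>h \<le> s\<close>; at \<open>h = s\<close> the
  two noise terms equal \<open>2 \<sigma> D\<close> and \<open>3 \<sigma> D\<close> with \<open>D = sqrt (\<Delta>1 L / T)\<close>, whence the constant \<open>5\<close>.
  If \<open>\<Delta>1 = 0\<close>, this step size is \<open>0\<close>; then the iterates stay at \<open>x1\<close>, a minimiser of \<open>f\<close>.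
  For \<open>\<eta> t = 1 / (L sqrt t)\<close> the squared step sizes sum to \<open>1 / L\<^sup>2\<close> times a harmonic number, and all weights are at
  least \<open>1 / (L sqrt T)\<close>.\<close>

theorem theorem4p1:
  fixes f :: "real ^ 'd \<Rightarrow> real"
    and gradf :: "real ^ 'd \<Rightarrow> real ^ 'd"
    and K :: "real ^ 'd \<Rightarrow> (real ^ 'd) measure"
    and M :: "'s measure"
    and x g :: "nat \<Rightarrow> 's \<Rightarrow> real ^ 'd"
    and x1 :: "real ^ 'd"
    and \<eta> :: "nat \<Rightarrow> real"
    and L \<sigma> \<delta> \<Delta>1 :: real
    and T :: nat
  assumes "prob_space M"
    and "L_smooth L f gradf"
    and "bdd_below (range f)"
    and "\<sigma> > 0"
    and "unbiased_sub_gaussian_oracle \<sigma> gradf K"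
    and "T \<ge> 1"
    and "0 < \<delta>" and "\<delta> < 1"
    and "SGD_run M gradf K \<eta> T x1 x g"
    and "\<Delta>1 = f x1 - (INF y. f y)"
  shows
    "((\<forall>t\<in>{1..T}. \<eta> t = min (1 / L) (sqrt (\<Delta>1 / (\<sigma>\<^sup>2 * L * real T)))) \<longrightarrow>
        \<P>(\<omega> in M. (1 / real T) * (\<Sum>t=1..T. (norm (gradf (x t \<omega>)))\<^sup>2)
             \<le> 2 * \<Delta>1 * L / real T + 5 * \<sigma> * sqrt (\<Delta>1 * L / real T)
               + 12 * \<sigma>\<^sup>2 * ln (1 / \<delta>) / real T) \<ge> 1 - \<delta>) \<and>
     ((\<forall>t\<in>{1..T}. \<eta> t = 1 / (L * sqrt (real t))) \<longrightarrow>
        \<P>(\<omega> in M. (1 / real T) * (\<Sum>t=1..T. (norm (gradf (x t \<omega>)))\<^sup>2)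
             \<le> (2 * \<Delta>1 * L + 3 * \<sigma>\<^sup>2 * (1 + ln (real T)) + 12 * \<sigma>\<^sup>2 * ln (1 / \<delta>))
               / sqrt (real T)) \<ge> 1 - \<delta>)"
proof (intro conjI impI)
  interpret sgd M f gradf K \<eta> T x1 x g L \<sigma>
    using assms by (intro sgd.intro sgd_axioms.intro)
  define G where "G t \<omega> = (norm (gradf (x t \<omega>)))\<^sup>2" for t \<omega>
  have \<Delta>0: "\<Delta>1 \<ge> 0"
    using cINF_lower[OF assms(3), of x1] assms(10) by simp
  have L: "L > 0" using assms(2) by (simp add: L_smooth_def)
  have T: "real T > 0" using assms(6) by simp
  have [measurable]: "x t \<in> borel_measurable M" if "1 \<le> t" "t \<le> T" for t
    using x_measurable_M[of t] that by simp
  have meas: "{\<omega> \<in> space M. (1 / real T) * (\<Sum>t=1..T. (norm (gradf (x t \<omega>)))\<^sup>2) \<le> c} \<in> events" for c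
    by measurable
  {
    assume \<eta>: "\<forall>t\<in>{1..T}. \<eta> t = min (1 / L) (sqrt (\<Delta>1 / (\<sigma>\<^sup>2 * L * real T)))"
    let ?A = "{\<omega> \<in> space M. (1 / real T) * (\<Sum>t=1..T. (norm (gradf (x t \<omega>)))\<^sup>2)
             \<le> 2 * \<Delta>1 * L / real T + 5 * \<sigma> * sqrt (\<Delta>1 * L / real T)
               + 12 * \<sigma>\<^sup>2 * ln (1 / \<delta>) / real T}"
    show "prob ?A \<ge> 1 - \<delta>"
    proof (cases "\<Delta>1 = 0")
      case True
      have x: "x t \<omega> = x1" if "1 \<le> t" "t \<le> Suc T" "\<omega> \<in> space M" for t \<omega>
        using that
      proof (induction t rule: dec_induct)
        case base
        then show ?case using x_1 by simp
      next
        case (step n)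
        then show ?case using \<eta> True L by (simp add: x_Suc)
      qed
      have "gradf x1 = 0"
        using L_smooth_norm_gradient_le[OF assms(2,3), of x1] True assms(10) by simp
      then have "?A = space M"
        using x assms True T by (auto intro!: divide_nonneg_nonneg mult_nonneg_nonneg)
      then show ?thesis using assms(7) prob_space by simp
    next
      case False
      then have \<Delta>: "\<Delta>1 > 0" using \<Delta>0 by simp
      define s where "s = sqrt (\<Delta>1 / (\<sigma>\<^sup>2 * L * real T))"
      define h where "h = min (1 / L) s"
      have s: "s > 0" using \<Delta> L T assms(4) by (simp add: s_def)
      have h: "h > 0" "L * h \<le> 1" "h \<le> s" "1 / h \<le> L + 1 / s"
        using L s by (auto simp: h_def min_def field_simps)
      have \<eta>h: "\<eta> t = h" if "t \<in> {1..T}" for t using \<eta> that by (simp add: h_def s_def)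
      define D where "D = sqrt (\<Delta>1 * L / real T)"
      have sD: "\<sigma> * L * s = D" "\<Delta>1 / (real T * s) = \<sigma> * D"
      proof -
        have "(\<sigma> * L * s)\<^sup>2 = \<Delta>1 * L / real T"
          using \<Delta> L T assms(4) by (simp add: s_def power_mult_distrib field_simps power2_eq_square)
        then show *: "\<sigma> * L * s = D"
          unfolding D_def using s L assms(4) by (intro real_sqrt_unique[symmetric]) auto
        have "s\<^sup>2 = \<Delta>1 / (\<sigma>\<^sup>2 * L * real T)"
          using \<Delta> L T assms(4) by (simp add: s_def)
        then show "\<Delta>1 / (real T * s) = \<sigma> * D"
          unfolding *[symmetric] using s L T assms(4) by (simp add: field_simps power2_eq_square)
      qed
      have "1 - \<delta> \<le> \<P>(\<omega> in M. (\<Sum>t=1..T. \<eta> t * (norm (gradf (x t \<omega>)))\<^sup>2)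
            \<le> 2 * (f x1 - (INF y. f y)) + 3 * \<sigma>\<^sup>2 * L * (\<Sum>t=1..T. (\<eta> t)\<^sup>2)
              + 12 * \<sigma>\<^sup>2 * h * ln (1 / \<delta>))"
        by (rule weighted_gradient_bound[OF assms(3,6) _ assms(7)]) (use h \<eta>h in auto)
      also have "\<dots> \<le> prob ?A"
      proof (rule finite_measure_mono[OF _ meas], safe)
        fix \<omega>
        assume "(\<Sum>t=1..T. \<eta> t * (norm (gradf (x t \<omega>)))\<^sup>2)
            \<le> 2 * (f x1 - (INF y. f y)) + 3 * \<sigma>\<^sup>2 * L * (\<Sum>t=1..T. (\<eta> t)\<^sup>2)
              + 12 * \<sigma>\<^sup>2 * h * ln (1 / \<delta>)"
        then have "h * (\<Sum>t=1..T. G t \<omega>)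
            \<le> 2 * \<Delta>1 + 3 * \<sigma>\<^sup>2 * L * (real T * h\<^sup>2) + 12 * \<sigma>\<^sup>2 * h * ln (1 / \<delta>)"
          using \<eta>h by (simp add: G_def sum_distrib_left assms(10))
        then have "h * (\<Sum>t=1..T. G t \<omega>) / (h * real T)
            \<le> (2 * \<Delta>1 + 3 * \<sigma>\<^sup>2 * L * (real T * h\<^sup>2) + 12 * \<sigma>\<^sup>2 * h * ln (1 / \<delta>)) / (h * real T)"
          using h T by (intro divide_right_mono) auto
        then have "(1 / real T) * (\<Sum>t=1..T. G t \<omega>)
            \<le> 2 * \<Delta>1 / real T * (1 / h) + 3 * \<sigma> * (\<sigma> * L * h) + 12 * \<sigma>\<^sup>2 * ln (1 / \<delta>) / real T"
          using h T by (simp add: field_simps power2_eq_square)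
        also have "2 * \<Delta>1 / real T * (1 / h) \<le> 2 * \<Delta>1 / real T * (L + 1 / s)"
          using h \<Delta> T by (intro mult_left_mono) auto
        also have "2 * \<Delta>1 / real T * (L + 1 / s) = 2 * \<Delta>1 * L / real T + 2 * (\<Delta>1 / (real T * s))"
          using T s by (simp add: field_simps)
        also have "3 * \<sigma> * (\<sigma> * L * h) \<le> 3 * \<sigma> * (\<sigma> * L * s)"
          using h L assms(4) by (intro mult_left_mono) auto
        finally show "(1 / real T) * (\<Sum>t=1..T. (norm (gradf (x t \<omega>)))\<^sup>2)
             \<le> 2 * \<Delta>1 * L / real T + 5 * \<sigma> * sqrt (\<Delta>1 * L / real T)
               + 12 * \<sigma>\<^sup>2 * ln (1 / \<delta>) / real T"
          unfolding sD D_def[symmetric] by (simp add: G_def mult.commute)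
      qed
      finally show ?thesis .
    qed
  next
    assume \<eta>: "\<forall>t\<in>{1..T}. \<eta> t = 1 / (L * sqrt (real t))"
    have step: "0 < \<eta> t \<and> L * \<eta> t \<le> 1 \<and> \<eta> t \<le> 1 / L" if "t \<in> {1..T}" for t
    proof -
      have r: "sqrt (real t) \<ge> 1" and \<eta>t: "\<eta> t = 1 / (L * sqrt (real t))" using \<eta> that by auto
      then have "1 / sqrt (real t) \<le> 1" "1 / (L * sqrt (real t)) = 1 / L * (1 / sqrt (real t))"
        by auto
      then show ?thesis
        unfolding \<eta>t using r L mult_left_mono[of "1 / sqrt (real t)" 1 "1 / L"] by simp
    qed
    have "1 - \<delta> \<le> \<P>(\<omega> in M. (\<Sum>t=1..T. \<eta> t * (norm (gradf (x t \<omega>)))\<^sup>2)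
            \<le> 2 * (f x1 - (INF y. f y)) + 3 * \<sigma>\<^sup>2 * L * (\<Sum>t=1..T. (\<eta> t)\<^sup>2)
              + 12 * \<sigma>\<^sup>2 * (1 / L) * ln (1 / \<delta>))"
      by (rule weighted_gradient_bound[OF assms(3,6) step assms(7)])
    also have "\<dots> \<le> \<P>(\<omega> in M. (1 / real T) * (\<Sum>t=1..T. (norm (gradf (x t \<omega>)))\<^sup>2)
             \<le> (2 * \<Delta>1 * L + 3 * \<sigma>\<^sup>2 * (1 + ln (real T)) + 12 * \<sigma>\<^sup>2 * ln (1 / \<delta>))
               / sqrt (real T))"
    proof (rule finite_measure_mono[OF _ meas], safe)
      fix \<omega>
      define S where "S = (\<Sum>t=1..T. 1 / real t)"
      assume *: "(\<Sum>t=1..T. \<eta> t * (norm (gradf (x t \<omega>)))\<^sup>2)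
            \<le> 2 * (f x1 - (INF y. f y)) + 3 * \<sigma>\<^sup>2 * L * (\<Sum>t=1..T. (\<eta> t)\<^sup>2)
              + 12 * \<sigma>\<^sup>2 * (1 / L) * ln (1 / \<delta>)"
      have "(\<Sum>t=1..T. (\<eta> t)\<^sup>2) = (\<Sum>t=1..T. (1 / L\<^sup>2) * (1 / real t))"
        using \<eta> by (intro sum.cong) (auto simp: power_divide power_mult_distrib)
      then have \<eta>2: "(\<Sum>t=1..T. (\<eta> t)\<^sup>2) = S / L\<^sup>2"
        by (simp add: S_def sum_divide_distrib mult.commute)
      have "1 / (L * sqrt (real T)) * (\<Sum>t=1..T. G t \<omega>) \<le> (\<Sum>t=1..T. \<eta> t * G t \<omega>)"
        unfolding sum_distrib_left
      proof (intro sum_mono mult_right_mono)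
        fix t assume "t \<in> {1..T}"
        then show "1 / (L * sqrt (real T)) \<le> \<eta> t"
          using \<eta> L by (auto intro!: divide_left_mono mult_pos_pos)
      qed (simp add: G_def)
      also have "\<dots> \<le> 2 * \<Delta>1 + 3 * \<sigma>\<^sup>2 * L * (S / L\<^sup>2) + 12 * \<sigma>\<^sup>2 * (1 / L) * ln (1 / \<delta>)"
        using * unfolding \<eta>2 G_def assms(10) .
      also have "\<dots> = (2 * \<Delta>1 * L + 3 * \<sigma>\<^sup>2 * S + 12 * \<sigma>\<^sup>2 * ln (1 / \<delta>)) / L"
        using L by (simp add: field_simps power2_eq_square)
      also have "\<dots> \<le> (2 * \<Delta>1 * L + 3 * \<sigma>\<^sup>2 * (1 + ln (real T)) + 12 * \<sigma>\<^sup>2 * ln (1 / \<delta>)) / L"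
        using sum_inverse_le_1_plus_ln[OF assms(6)] L \<Delta>0
        by (intro divide_right_mono add_mono mult_left_mono) (auto simp: S_def)
      finally have "(\<Sum>t=1..T. G t \<omega>) / sqrt (real T)
          \<le> 2 * \<Delta>1 * L + 3 * \<sigma>\<^sup>2 * (1 + ln (real T)) + 12 * \<sigma>\<^sup>2 * ln (1 / \<delta>)"
        using L by (simp add: field_simps)
      then have "(\<Sum>t=1..T. G t \<omega>) / sqrt (real T) / sqrt (real T)
          \<le> (2 * \<Delta>1 * L + 3 * \<sigma>\<^sup>2 * (1 + ln (real T)) + 12 * \<sigma>\<^sup>2 * ln (1 / \<delta>)) / sqrt (real T)"
        by (rule divide_right_mono) simp
      then show "(1 / real T) * (\<Sum>t=1..T. (norm (gradf (x t \<omega>)))\<^sup>2)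
             \<le> (2 * \<Delta>1 * L + 3 * \<sigma>\<^sup>2 * (1 + ln (real T)) + 12 * \<sigma>\<^sup>2 * ln (1 / \<delta>))
               / sqrt (real T)"
        by (simp add: G_def)
    qed
    finally show "\<P>(\<omega> in M. (1 / real T) * (\<Sum>t=1..T. (norm (gradf (x t \<omega>)))\<^sup>2)
             \<le> (2 * \<Delta>1 * L + 3 * \<sigma>\<^sup>2 * (1 + ln (real T)) + 12 * \<sigma>\<^sup>2 * ln (1 / \<delta>))
               / sqrt (real T)) \<ge> 1 - \<delta>" .
  }
qed

end
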